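(* Let $n\ge1$, $1\le\ell\le m$, and $$Q(\lambda,i\xi)=\sum_{j=0}^{\ell}P_{m-j}(\lambda,i\xi),$$ where $P_{m-j}(\partial_t,\partial_x)$ are homogeneous operators of degree $m-j$ on $\mathbb{R}_t\times\mathbb{R}^n_x$, with $c_{m,0}=1$ and $c_{m-\ell,0}>0$. Assume that $P_{m-1}(\partial_t,\partial_x)$ and $P_m(\partial_t,\partial_x)$ are strictly hyperbolic, and that $P_{m-1}(\lambda,\xi')$ and $P_m(\lambda,\xi')$ strictly interlace for any $\xi'\in S^{n-1}$. Then we may label the $m$ roots $\lambda_j(\xi)$ of $Q(\lambda,i\xi)$, $\xi\in\mathbb{R}^n$, in such a way that $$\lambda_j(\xi)=i|\xi|a_j(\xi')-\frac{P_{m-1}(a_j(\xi'),\xi')}{\check P_{m,j}(a_j(\xi'),\xi')}+o(1),\qquad j=1,\ldots,m,$$ as $|\xi|\to\infty$, where $a_j(\xi')$ are the $m$ real roots of $P_m(\lambda,\xi')$ and $\xi'=\xi/|\xi|\in S^{n-1}$.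
   Context: A homogeneous operator of order (degree) $r$ is $P_r(\partial_t,\partial_x)=\sum_{k+|\alpha|=r}c_{k,\alpha}\partial_t^k\partial_x^\alpha$ with constant coefficients; its symbol is $P_r(\lambda,\xi)=\sum_{k+|\alpha|=r}c_{k,\alpha}\lambda^k\xi^\alpha$, and $P_r(\lambda,i\xi)$ denotes the symbol with $\xi$ replaced by $i\xi$. It is strictly hyperbolic if $c_{r,0}>0$ and, for every $\xi'\in S^{n-1}=\{\xi\in\mathbb{R}^n:|\xi|=1\}$, the polynomial $\lambda\mapsto P_r(\lambda,\xi')$ has only real and distinct roots. If $p_{r-1}$, $p_r$ are polynomials of degree $r-1$, $r$ with real roots $\tilde\lambda_1\le\dots\le\tilde\lambda_{r-1}$ and $\lambda_1\le\dots\le\lambda_r$, they strictly interlace if $\lambda_1<\tilde\lambda_1<\lambda_2<\dots<\tilde\lambda_{r-1}<\lambda_r$. $\check P_{m,j}(\lambda,\xi')=P_m(\lambda,\xi')/(\lambda-a_j(\xi'))$ (a polynomial in $\lambda$). *)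

theory Defs
  imports
    "HOL-Analysis.Analysis"
    "HOL-Computational_Algebra.Polynomial"
    "HOL-Library.Landau_Symbols"
    "HOL-Library.Complex_Order"
begin

text \<open>
  A multi-index is a function \<^typ>\<open>'n \<Rightarrow> nat\<close>.  One coefficient family \<open>c\<close>, with \<open>c k \<alpha>\<close> the
  coefficient of \<open>\<partial>\<^sub>t\<^sup>k \<partial>\<^sub>x\<^sup>\<alpha>\<close>, carries homogeneous operators \<open>P\<^sub>r\<close> of every order \<open>r\<close> at once: \<open>P\<^sub>r\<close>
  uses precisely the \<open>c k \<alpha>\<close> with \<open>k + |\<alpha>| = r\<close>, and these index sets are disjoint for
  different \<open>r\<close>.  Coefficients are complex; \<open>x > 0\<close> for complex \<open>x\<close> (order of Complex_Order)
  means that \<open>x\<close> is real and positive.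
\<close>

definition mi_order :: "('n::finite \<Rightarrow> nat) \<Rightarrow> nat" where
  "mi_order \<alpha> = (\<Sum>i\<in>UNIV. \<alpha> i)"

text \<open>
  The symbol \<open>P\<^sub>r(\<lambda>, \<zeta>)\<close> as a polynomial in \<open>\<lambda>\<close>.  The second argument is a complex vector so that
  both \<open>\<zeta> = \<xi>\<close> and \<open>\<zeta> = i\<xi>\<close> (for real \<open>\<xi>\<close>) can be inserted.
\<close>

definition symb :: "(nat \<Rightarrow> ('n::finite \<Rightarrow> nat) \<Rightarrow> complex) \<Rightarrow> nat \<Rightarrow> complex ^ 'n \<Rightarrow> complex poly" where
  "symb c r \<zeta> =
     (\<Sum>(k, \<alpha>) \<in> {(k, \<alpha>). k + mi_order \<alpha> = r}. monom (c k \<alpha> * (\<Prod>i\<in>UNIV. (\<zeta> $ i) ^ \<alpha> i)) k)"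

lemma finite_symb_index: "finite {(k, \<alpha> :: 'n::finite \<Rightarrow> nat). k + mi_order \<alpha> = r}"
proof (rule finite_subset)
  show "{(k, \<alpha> :: 'n \<Rightarrow> nat). k + mi_order \<alpha> = r} \<subseteq> {..r} \<times> PiE UNIV (\<lambda>_. {..r})"
  proof (clarsimp simp: PiE_UNIV_domain mi_order_def)
    fix k and \<alpha> :: "'n \<Rightarrow> nat" and i
    have "\<alpha> i \<le> sum \<alpha> UNIV" by (rule member_le_sum) auto
    then show "\<alpha> i \<le> k + sum \<alpha> UNIV" by simp
  qed
  show "finite ({..r} \<times> PiE (UNIV :: 'n set) (\<lambda>_. {..r}))"
    by (intro finite_cartesian_product finite_PiE) auto
qed

definition cvec :: "real ^ 'n \<Rightarrow> complex ^ 'n" where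
  "cvec \<xi> = (\<chi> i. complex_of_real (\<xi> $ i))"

definition ivec :: "real ^ 'n \<Rightarrow> complex ^ 'n" where
  "ivec \<xi> = (\<chi> i. \<i> * complex_of_real (\<xi> $ i))"

definition strictly_hyperbolic :: "(nat \<Rightarrow> ('n::finite \<Rightarrow> nat) \<Rightarrow> complex) \<Rightarrow> nat \<Rightarrow> bool" where
  "strictly_hyperbolic c r \<longleftrightarrow>
     c r (\<lambda>_. 0) > 0 \<and>
     (\<forall>\<omega> :: real ^ 'n. norm \<omega> = 1 \<longrightarrow>
        (\<forall>z. poly (symb c r (cvec \<omega>)) z = 0 \<longrightarrow> z \<in> \<real>) \<and> rsquarefree (symb c r (cvec \<omega>)))"

text \<open>\<open>x 1 \<le> \<dots> \<le> x r\<close> are the roots, with multiplicity, of the polynomial \<open>p\<close> of degree \<open>r\<close>.\<close>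

definition ordered_real_roots :: "complex poly \<Rightarrow> nat \<Rightarrow> (nat \<Rightarrow> real) \<Rightarrow> bool" where
  "ordered_real_roots p r x \<longleftrightarrow>
     degree p = r \<and> mono_on {1..r} x \<and>
     proots p = image_mset (\<lambda>j. complex_of_real (x j)) (mset_set {1..r})"

text \<open>\<open>p\<close> has degree \<open>r - 1\<close> and \<open>q\<close> has degree \<open>r\<close>.\<close>

definition strictly_interlace :: "nat \<Rightarrow> complex poly \<Rightarrow> complex poly \<Rightarrow> bool" where
  "strictly_interlace r p q \<longleftrightarrow>
     (\<exists>\<mu> \<nu>. ordered_real_roots p (r - 1) \<mu> \<and> ordered_real_roots q r \<nu> \<and>
        (\<forall>k\<in>{1..<r}. \<nu> k < \<mu> k \<and> \<mu> k < \<nu> (k + 1)))"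

definition Qpoly :: "(nat \<Rightarrow> ('n::finite \<Rightarrow> nat) \<Rightarrow> complex) \<Rightarrow> nat \<Rightarrow> nat \<Rightarrow> complex ^ 'n \<Rightarrow> complex poly" where
  "Qpoly c m l \<zeta> = (\<Sum>j=0..l. symb c (m - j) \<zeta>)"

definition symb_check ::
  "(nat \<Rightarrow> ('n::finite \<Rightarrow> nat) \<Rightarrow> complex) \<Rightarrow> nat \<Rightarrow> complex \<Rightarrow> complex ^ 'n \<Rightarrow> complex poly" where
  "symb_check c m a \<zeta> = symb c m \<zeta> div [:- a, 1:]"

end

theory Submission
  imports Defs "HOL-Computational_Algebra.Fundamental_Theorem_Algebra"
begin

text \<open>
  Write \<open>\<xi> = \<rho> \<omega>\<close> with \<open>|\<omega>| = 1\<close>, and put \<open>s = i \<rho>\<close>.  By homogeneity \<open>P\<^sub>r(s x, i\<xi>) = s\<^sup>r P\<^sub>r(x, \<omega>)\<close>, so the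
  roots of \<open>Q(\<cdot>, i\<xi>)\<close> are \<open>s\<close> times the roots of
  \<open>g = P\<^sub>m(\<cdot>, \<omega>) + t P\<^sub>m\<^sub>-\<^sub>1(\<cdot>, \<omega>) + t\<^sup>2 r\<close>, where \<open>t = 1 / s\<close> and \<open>r\<close> gathers the operators of lower order.
  For large \<open>\<rho>\<close> this is a small perturbation of \<open>P\<^sub>m(\<cdot>, \<omega>)\<close>, all of whose roots \<open>a\<^sub>j\<close> are simple.  One
  Newton step predicts a root of \<open>g\<close> at \<open>a\<^sub>j - t P\<^sub>m\<^sub>-\<^sub>1(a\<^sub>j, \<omega>) / P\<^sub>m'(a\<^sub>j, \<omega>)\<close> up to \<open>O(t\<^sup>2)\<close>.  Multiplication
  by \<open>s\<close> turns this into the asserted expansion with error \<open>O(1 / \<rho>)\<close>, because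
  \<open>P\<^sub>m(x) / (x - a\<^sub>j)\<close> has the value \<open>P\<^sub>m'(a\<^sub>j)\<close> at \<open>x = a\<^sub>j\<close> (\<open>poly_symb_check_root\<close>).

  That a root of \<open>g\<close> really lies near the predicted point \<open>z\<close> follows, without Rouche's theorem, from
  \<open>g'(z) / g(z) = \<Sum> 1 / (z - w)\<close>, the sum being over the roots \<open>w\<close> of \<open>g\<close>: the distance from \<open>z\<close> to
  the nearest root is at most \<open>deg g \<cdot> |g(z) / g'(z)|\<close> (\<open>ex_root_near\<close>).  A Taylor expansion at \<open>a\<^sub>j\<close> gives
  \<open>g(z) = O(t\<^sup>2)\<close> and \<open>g'(z) = P\<^sub>m'(a\<^sub>j) + O(t)\<close>.  The \<open>a\<^sub>j\<close> keep a fixed distance from each other, so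
  the \<open>m\<close> roots found in this way are distinct (\<open>perturbed_roots\<close>) and exhaust the roots of \<open>Q\<close>.

  The labelling \<open>a\<^sub>j(\<omega>)\<close> may be discontinuous in \<open>\<omega>\<close>.  Uniformity is therefore obtained from
  continuous quantities: the set of pairs \<open>(\<omega>, x)\<close> with \<open>|\<omega>| = 1\<close> and \<open>P\<^sub>m(x, \<omega>) = 0\<close> is compact and
  \<open>P\<^sub>m'(x, \<omega>)\<close> does not vanish on it, which yields a positive lower bound \<open>\<delta>\<close> for \<open>|P\<^sub>m'|\<close> at all roots
  (\<open>pderiv_symb_bounded_below\<close>).  Together with upper bounds \<open>K\<close> for the polynomials and their
  derivatives near the roots, every constant of the argument depends on \<open>m\<close>, \<open>K\<close> and \<open>\<delta>\<close> only.
\<close>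

section \<open>Roots of a complex polynomial\<close>

lemma ex_image_mset_of_size:
  assumes "size M = m"
  shows "\<exists>f. M = image_mset f (mset_set {1..m::nat})"
proof -
  obtain xs where xs: "mset xs = M" using ex_mset by blast
  with assms have len: "length xs = m" by (metis size_mset)
  have "map (\<lambda>j. xs ! (j - 1)) [1..<Suc m] = xs"
    by (rule nth_equalityI) (auto simp: len nth_append simp del: upt_Suc)
  then have "image_mset (\<lambda>j. xs ! (j - 1)) (mset [1..<Suc m]) = M"
    by (metis mset_map xs)
  moreover have "mset [1..<Suc m] = mset_set {1..m}"
    by (metis atLeastLessThanSuc_atLeastAtMost mset_upt)
  ultimately show ?thesis by metis
qed

lemma proots_eq_if_distinct_roots:
  fixes p :: "complex poly"
  assumes "p \<noteq> 0" and "degree p = m" and inj: "inj_on f {1..m}"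
    and root: "\<And>j. j \<in> {1..m} \<Longrightarrow> poly p (f j) = 0"
  shows "proots p = image_mset f (mset_set {1..m})"
proof -
  have "mset_set (f ` {1..m}) \<subseteq># proots p"
    by (rule subset_imp_msubset_mset_set[THEN subset_mset.trans, OF _ _ mset_set_set_mset_msubset])
       (use assms in \<open>auto simp: poly_roots_finite\<close>)
  moreover have "size (mset_set (f ` {1..m})) = size (proots p)"
    using assms by (simp add: size_proots_complex card_image)
  ultimately have "mset_set (f ` {1..m}) = proots p"
    by (metis mset_subset_size nat_neq_iff subset_mset.nless_le)
  then show ?thesis using image_mset_mset_set[OF inj] by metis
qed

text \<open>
  A form of \<open>p'(z) / p(z) = \<Sum> 1 / (z - x)\<close> without quotients, which also covers the case that \<open>z\<close> is
  a root.
\<close>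

lemma norm_pderiv_prod_linear_le:
  fixes z :: complex
  assumes "\<And>x. x \<in># M \<Longrightarrow> d \<le> norm (z - x)" and "0 \<le> d"
  shows "d * norm (poly (pderiv (\<Prod>x\<in>#M. [:-x, 1:])) z)
    \<le> real (size M) * norm (poly (\<Prod>x\<in>#M. [:-x, 1:]) z)"
  using assms(1)
proof (induction M)
  case empty
  then show ?case by simp
next
  case (add x M)
  define q where "q = (\<Prod>x\<in>#M. [:-x, 1:])"
  have IH: "d * norm (poly (pderiv q) z) \<le> real (size M) * norm (poly q z)"
    unfolding q_def using add by simp
  have dx: "d \<le> norm (z - x)" using add.prems by simp
  have "poly (pderiv ([:-x, 1:] * q)) z = poly q z + (z - x) * poly (pderiv q) z"
    by (simp only: pderiv_mult) (simp add: pderiv_pCons algebra_simps)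
  then have "d * norm (poly (pderiv ([:-x, 1:] * q)) z)
      \<le> d * (norm (poly q z) + norm (z - x) * norm (poly (pderiv q) z))"
    by (metis assms(2) mult_left_mono norm_mult norm_triangle_ineq)
  also have "\<dots> = d * norm (poly q z) + norm (z - x) * (d * norm (poly (pderiv q) z))"
    by (simp add: algebra_simps)
  also have "\<dots> \<le> norm (z - x) * norm (poly q z)
      + norm (z - x) * (real (size M) * norm (poly q z))"
    by (intro add_mono mult_right_mono mult_left_mono dx IH) auto
  also have "\<dots> = real (size (add_mset x M)) * norm (poly ([:-x, 1:] * q) z)"
    by (simp add: norm_mult algebra_simps flip: norm_mult)
  finally show ?case by (simp add: q_def)
qed

text \<open>
  Apply the preceding bound with \<open>d\<close> the distance from \<open>z\<close> to the nearest root; there is one, since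
  \<open>p'(z) \<noteq> 0\<close> excludes constant \<open>p\<close>.
\<close>

lemma ex_root_near:
  fixes p :: "complex poly"
  assumes "poly (pderiv p) z \<noteq> 0"
  shows "\<exists>w. poly p w = 0 \<and> norm (w - z) * norm (poly (pderiv p) z) \<le> real (degree p) * norm (poly p z)"
proof -
  have p0: "p \<noteq> 0" using assms by auto
  have "degree p \<noteq> 0"
    using assms by (metis pderiv_eq_0_iff poly_0)
  then have "proots p \<noteq> {#}" by (metis size_empty size_proots_complex)
  then obtain w where w: "w \<in># proots p" and min: "\<And>x. x \<in># proots p \<Longrightarrow> norm (z - w) \<le> norm (z - x)"
    using ex_is_arg_min_if_finite[of "set_mset (proots p)" "\<lambda>x. norm (z - x)"]
    by (auto simp: is_arg_min_linorder)
  define q where "q = (\<Prod>x\<in>#proots p. [:-x, 1:])"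
  have pq: "p = smult (lead_coeff p) q"
    unfolding q_def by (rule complex_poly_decompose_multiset[symmetric])
  have "norm (z - w) * norm (poly (pderiv q) z) \<le> real (degree p) * norm (poly q z)"
    unfolding q_def by (rule norm_pderiv_prod_linear_le[of "proots p" "norm (z - w)" z,
        unfolded size_proots_complex]) (use min in auto)
  then have "norm (lead_coeff p) * (norm (z - w) * norm (poly (pderiv q) z))
      \<le> norm (lead_coeff p) * (real (degree p) * norm (poly q z))"
    by (rule mult_left_mono) auto
  moreover have "poly (pderiv p) z = lead_coeff p * poly (pderiv q) z"
    by (subst pq) (simp only: pderiv_smult poly_smult)
  moreover have "poly p z = lead_coeff p * poly q z"
    by (subst pq) (simp only: poly_smult)
  ultimately have "norm (w - z) * norm (poly (pderiv p) z) \<le> real (degree p) * norm (poly p z)"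
    by (simp add: norm_mult mult_ac norm_minus_commute)
  then show ?thesis using w p0 by auto
qed

lemma norm_root_le_of_monic:
  fixes p :: "complex poly"
  assumes "degree p = m" and "coeff p m = 1" and root: "poly p z = 0"
    and B: "\<And>k. k < m \<Longrightarrow> norm (coeff p k) \<le> B"
  shows "norm z \<le> max 1 (real m * B)"
proof (cases "norm z \<le> 1")
  case False
  have m: "m \<noteq> 0"
  proof
    assume "m = 0"
    then have "p = 1" using assms(1,2) by (metis degree_eq_zeroE coeff_pCons_0 one_pCons)
    then show False using root by simp
  qed
  have "z ^ m = - (\<Sum>k<m. coeff p k * z ^ k)"
    using root assms(1,2) unfolding poly_altdef
    by (simp add: atMost_Suc lessThan_Suc_atMost[symmetric] add_eq_0_iff)
  then have "norm z ^ m = norm (\<Sum>k<m. coeff p k * z ^ k)"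
    by (metis norm_minus_cancel norm_power)
  also have "\<dots> \<le> (\<Sum>k<m. B * norm z ^ (m - 1))"
  proof (rule sum_norm_le)
    fix k assume "k \<in> {..<m}"
    then have "norm (coeff p k) * norm z ^ k \<le> B * norm z ^ (m - 1)"
      using False B[of k] by (intro mult_mono power_increasing) (auto intro: order_trans[OF norm_ge_zero])
    then show "norm (coeff p k * z ^ k) \<le> B * norm z ^ (m - 1)"
      by (simp add: norm_mult norm_power)
  qed
  finally have "norm z * norm z ^ (m - 1) \<le> (real m * B) * norm z ^ (m - 1)"
    using m by (simp add: power_eq_if)
  then have "norm z \<le> real m * B"
    by (rule mult_right_le_imp_le) (use False in \<open>intro zero_less_power, linarith\<close>)
  then show ?thesis by simp
qed simp

section \<open>Perturbation of simple roots\<close>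

lemma poly_diff_le:
  fixes p :: "complex poly"
  assumes "\<And>x. x \<in> cball a 1 \<Longrightarrow> norm (poly (pderiv p) x) \<le> K" and "norm h \<le> 1"
  shows "norm (poly p (a + h) - poly p a) \<le> K * norm h"
  using field_differentiable_bound[of "cball a 1" "poly p" "poly (pderiv p)" K "a + h" a] assms
  by (auto intro: DERIV_subset[OF poly_DERIV] simp: dist_norm)

lemma poly_taylor1_le:
  fixes p :: "complex poly"
  assumes "\<And>x. x \<in> cball a 1 \<Longrightarrow> norm (poly (pderiv (pderiv p)) x) \<le> K" and "norm h \<le> 1"
  shows "norm (poly p (a + h) - poly p a - poly (pderiv p) a * h) \<le> K * (norm h)\<^sup>2"
proof -
  have "norm (poly ((pderiv ^^ 0) p) (a + h)
      - (\<Sum>i\<le>1. poly ((pderiv ^^ i) p) a * (a + h - a) ^ i / fact i))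
      \<le> K * norm (a + h - a) ^ Suc 1 / fact 1"
    by (rule complex_Taylor[of "cball a 1"])
       (use assms in \<open>auto intro: DERIV_subset[OF poly_DERIV] simp: dist_norm numeral_2_eq_2\<close>)
  then show ?thesis by (simp add: numeral_2_eq_2 algebra_simps)
qed

text \<open>
  The root is sought near \<open>z = a - t b\<close> with \<open>b = q(a) / p'(a)\<close>, the point at which the terms of order
  one in \<open>t\<close> of \<open>g = p + t q + t\<^sup>2 r\<close> cancel.  With \<open>\<kappa> = K / \<delta> \<ge> 1\<close> one has \<open>|b| \<le> \<kappa>\<close>, hence
  \<open>|g(z)| \<le> K |t|\<^sup>2 (\<kappa>\<^sup>2 + \<kappa> + 1) \<le> 3 K \<kappa>\<^sup>2 |t|\<^sup>2\<close>.  The smallness assumption on \<open>t\<close> makes the change of the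
  derivative at most \<open>\<delta> / 2\<close>, so \<open>|g'(z)| \<ge> \<delta> / 2\<close>.  The quotient of the two bounds, times \<open>m\<close>, is
  the stated error.
\<close>

lemma ex_root_of_perturbation:
  fixes p q r :: "complex poly" and a t :: complex
  defines "g \<equiv> p + smult t q + smult (t\<^sup>2) r"
  assumes pa: "poly p a = 0" and \<delta>: "0 < \<delta>" "\<delta> \<le> norm (poly (pderiv p) a)"
    and Kp: "\<And>x. x \<in> cball a 1 \<Longrightarrow> norm (poly (pderiv p) x) \<le> K"
      "\<And>x. x \<in> cball a 1 \<Longrightarrow> norm (poly (pderiv (pderiv p)) x) \<le> K"
    and Kq: "\<And>x. x \<in> cball a 1 \<Longrightarrow> norm (poly q x) \<le> K"
      "\<And>x. x \<in> cball a 1 \<Longrightarrow> norm (poly (pderiv q) x) \<le> K"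
    and Kr: "\<And>x. x \<in> cball a 1 \<Longrightarrow> norm (poly r x) \<le> K"
      "\<And>x. x \<in> cball a 1 \<Longrightarrow> norm (poly (pderiv r) x) \<le> K"
    and deg: "degree g \<le> m"
    and t: "norm t * (6 * (K / \<delta>)\<^sup>2) \<le> 1"
  shows "\<exists>\<mu>. poly g \<mu> = 0 \<and>
    norm (\<mu> - (a - t * (poly q a / poly (pderiv p) a))) \<le> 6 * real m * (K / \<delta>) ^ 3 * (norm t)\<^sup>2"
proof -
  define \<kappa> where "\<kappa> = K / \<delta>"
  define \<tau> where "\<tau> = norm t"
  define b where "b = poly q a / poly (pderiv p) a"
  define h where "h = - t * b"
  have \<tau>0: "0 \<le> \<tau>" by (simp add: \<tau>_def)
  have p'0: "poly (pderiv p) a \<noteq> 0" using \<delta> by auto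
  have \<delta>K: "\<delta> \<le> K" using \<delta> Kp(1)[of a] by simp
  then have \<kappa>1: "1 \<le> \<kappa>" using \<delta> by (simp add: \<kappa>_def)
  have K: "K = \<kappa> * \<delta>" using \<delta> by (simp add: \<kappa>_def)
  have t6: "\<tau> * (6 * \<kappa>\<^sup>2) \<le> 1" using t by (simp add: \<tau>_def \<kappa>_def)
  have b: "norm b \<le> \<kappa>"
    unfolding b_def \<kappa>_def norm_divide using \<delta> \<delta>K Kq(1)[of a] by (intro frac_le) auto
  have \<kappa>sq: "\<kappa> \<le> \<kappa>\<^sup>2" "1 \<le> \<kappa>\<^sup>2"
    using \<kappa>1 power_increasing[of 1 2 \<kappa>] by auto
  have \<tau>\<kappa>: "6 * (\<tau> * \<kappa>) \<le> 1" "6 * \<tau> \<le> 1"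
    using t6 mult_left_mono[OF \<kappa>sq(1) \<tau>0] mult_left_mono[OF \<kappa>sq(2) \<tau>0] by auto
  have nh: "norm h \<le> \<tau> * \<kappa>"
    unfolding h_def using b by (auto simp: norm_mult \<tau>_def intro: mult_left_mono)
  then have h1: "norm h \<le> 1" using \<tau>\<kappa> by linarith
  have ball: "a + h \<in> cball a 1" using h1 by (simp add: dist_norm)
  have K0: "0 \<le> K" using \<delta> \<delta>K by simp

  have "poly g (a + h) = (poly p (a + h) - poly p a - poly (pderiv p) a * h)
      + t * (poly q (a + h) - poly q a) + t\<^sup>2 * poly r (a + h)"
    using p'0 by (simp add: g_def pa h_def b_def algebra_simps)
  also have "norm \<dots> \<le> K * (norm h)\<^sup>2 + \<tau> * (K * norm h) + \<tau>\<^sup>2 * K"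
    by (intro norm_triangle_mono)
       (auto simp: norm_mult norm_power \<tau>_def
         intro!: mult_left_mono poly_taylor1_le poly_diff_le Kp(2) Kq(2) Kr(1) h1 ball)
  also have "\<dots> \<le> K * (\<tau> * \<kappa>)\<^sup>2 + \<tau> * (K * (\<tau> * \<kappa>)) + \<tau>\<^sup>2 * K"
    by (intro add_mono mult_left_mono power_mono nh) (use K0 \<tau>0 in auto)
  also have "\<dots> = (K * \<tau>\<^sup>2) * (\<kappa>\<^sup>2 + \<kappa> + 1)" by (simp add: algebra_simps power2_eq_square)
  also have "\<dots> \<le> (K * \<tau>\<^sup>2) * (3 * \<kappa>\<^sup>2)"
    by (intro mult_left_mono) (use K0 \<kappa>sq in auto)
  finally have g: "norm (poly g (a + h)) \<le> 3 * \<kappa> ^ 3 * \<delta> * \<tau>\<^sup>2"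
    by (simp add: K power2_eq_square power3_eq_cube mult_ac)

  have "poly (pderiv p) a = poly (pderiv g) (a + h) - ((poly (pderiv p) (a + h) - poly (pderiv p) a)
      + t * poly (pderiv q) (a + h) + t\<^sup>2 * poly (pderiv r) (a + h))"
    by (simp add: g_def pderiv_add pderiv_smult)
  also have "norm \<dots> \<le> norm (poly (pderiv g) (a + h)) + (K * norm h + \<tau> * K + \<tau>\<^sup>2 * K)"
    by (rule order_trans[OF norm_triangle_ineq4], intro add_left_mono norm_triangle_mono)
       (auto simp: norm_mult norm_power \<tau>_def
         intro!: mult_left_mono poly_diff_le Kp(2) Kq(2) Kr(2) h1 ball)
  also have "\<dots> \<le> norm (poly (pderiv g) (a + h)) + (K * (\<tau> * \<kappa>) + \<tau> * K + \<tau> * K)"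
    by (intro add_mono mult_left_mono mult_right_mono nh)
       (use K0 \<tau>0 \<tau>\<kappa> in \<open>auto simp: power2_eq_square intro: mult_left_le_one_le\<close>)
  also have "\<dots> = norm (poly (pderiv g) (a + h)) + \<delta> * (\<tau> * \<kappa>\<^sup>2 + 2 * (\<tau> * \<kappa>))"
    by (simp add: K algebra_simps power2_eq_square)
  also have "\<dots> \<le> norm (poly (pderiv g) (a + h)) + \<delta> * (1 / 2)"
    by (intro add_left_mono mult_left_mono) (use \<delta> t6 \<tau>\<kappa> in linarith)+
  finally have g': "\<delta> / 2 \<le> norm (poly (pderiv g) (a + h))"
    using \<delta> by simp
  then have "poly (pderiv g) (a + h) \<noteq> 0" using \<delta> by auto
  then obtain \<mu> where \<mu>: "poly g \<mu> = 0"
    and le: "norm (\<mu> - (a + h)) * norm (poly (pderiv g) (a + h)) \<le> real (degree g) * norm (poly g (a + h))"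
    using ex_root_near by blast
  have "norm (\<mu> - (a + h)) * (\<delta> / 2) \<le> norm (\<mu> - (a + h)) * norm (poly (pderiv g) (a + h))"
    using g' by (intro mult_left_mono) auto
  also note le
  also have "real (degree g) * norm (poly g (a + h)) \<le> real m * (3 * \<kappa> ^ 3 * \<delta> * \<tau>\<^sup>2)"
    using deg g by (intro mult_mono) auto
  finally have "\<delta> * norm (\<mu> - (a + h)) \<le> \<delta> * (6 * real m * \<kappa> ^ 3 * \<tau>\<^sup>2)"
    by (simp add: mult_ac)
  then have "norm (\<mu> - (a + h)) \<le> 6 * real m * \<kappa> ^ 3 * \<tau>\<^sup>2"
    using \<delta> by (metis mult_le_cancel_left_pos)
  then show ?thesis using \<mu> by (auto simp: h_def b_def \<kappa>_def \<tau>_def)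
qed

text \<open>
  If \<open>b\<close> is another root close to \<open>a\<close>, then the linear Taylor term \<open>p'(a) (b - a)\<close> must be compensated by
  the quadratic remainder, so \<open>\<delta> |b - a| \<le> K |b - a|\<^sup>2\<close>.  At distance more than \<open>1\<close> the bound holds
  because \<open>\<delta> \<le> |p'(a)| \<le> K\<close>.
\<close>

lemma simple_roots_separated:
  fixes p :: "complex poly"
  assumes "poly p a = 0" "poly p b = 0" "a \<noteq> b"
    and \<delta>: "0 < \<delta>" "\<delta> \<le> norm (poly (pderiv p) a)"
    and K: "\<And>x. x \<in> cball a 1 \<Longrightarrow> norm (poly (pderiv p) x) \<le> K"
      "\<And>x. x \<in> cball a 1 \<Longrightarrow> norm (poly (pderiv (pderiv p)) x) \<le> K"
  shows "\<delta> / K \<le> norm (a - b)"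
proof -
  have \<delta>K: "\<delta> \<le> K" using \<delta> K(1)[of a] by simp
  show ?thesis
  proof (cases "norm (b - a) \<le> 1")
    case True
    have "norm (poly (pderiv p) a) * norm (b - a) \<le> K * (norm (b - a))\<^sup>2"
      using poly_taylor1_le[of a p K "b - a"] K(2) True assms(1,2) by (simp add: norm_mult)
    moreover have "\<delta> * norm (b - a) \<le> norm (poly (pderiv p) a) * norm (b - a)"
      using \<delta> by (intro mult_right_mono) auto
    ultimately have "\<delta> * norm (b - a) \<le> (K * norm (b - a)) * norm (b - a)"
      by (simp add: power2_eq_square)
    then have "\<delta> \<le> K * norm (b - a)" using assms(3) by (simp add: mult_le_cancel_right)
    then show ?thesis using \<delta> \<delta>K by (simp add: field_simps norm_minus_commute)
  next
    case False
    moreover have "\<delta> / K \<le> 1" using \<delta> \<delta>K by simp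
    ultimately show ?thesis by (simp add: norm_minus_commute)
  qed
qed

text \<open>
  The roots \<open>a j\<close> are at least \<open>\<delta> / K\<close> apart.  The bound on \<open>t\<close> is chosen so that no root moves by more
  than an eighth of this distance; the perturbed roots therefore remain distinct.
\<close>

lemma perturbed_roots:
  fixes p q r :: "complex poly" and a :: "nat \<Rightarrow> complex" and t :: complex
  defines "g \<equiv> p + smult t q + smult (t\<^sup>2) r"
  assumes inj: "inj_on a {1..m}" and pa: "\<And>j. j \<in> {1..m} \<Longrightarrow> poly p (a j) = 0"
    and \<delta>: "0 < \<delta>" "\<And>j. j \<in> {1..m} \<Longrightarrow> \<delta> \<le> norm (poly (pderiv p) (a j))"
    and K: "\<And>j x. j \<in> {1..m} \<Longrightarrow> x \<in> cball (a j) 1 \<Longrightarrow>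
      norm (poly (pderiv p) x) \<le> K \<and> norm (poly (pderiv (pderiv p)) x) \<le> K \<and>
      norm (poly q x) \<le> K \<and> norm (poly (pderiv q) x) \<le> K \<and>
      norm (poly r x) \<le> K \<and> norm (poly (pderiv r) x) \<le> K"
    and deg: "degree g \<le> m"
    and t: "norm t * (12 * real m * (K / \<delta>)\<^sup>2) \<le> 1"
  shows "\<exists>\<mu>. inj_on \<mu> {1..m} \<and> (\<forall>j\<in>{1..m}. poly g (\<mu> j) = 0 \<and>
    norm (\<mu> j - (a j - t * (poly q (a j) / poly (pderiv p) (a j))))
      \<le> 6 * real m * (K / \<delta>) ^ 3 * (norm t)\<^sup>2)"
proof (cases "m = 0")
  case False
  define \<kappa> where "\<kappa> = K / \<delta>"
  define \<tau> where "\<tau> = norm t"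
  define N where "N = real m"
  have N1: "1 \<le> N" using False by (simp add: N_def)
  have \<tau>0: "0 \<le> \<tau>" by (simp add: \<tau>_def)
  have \<delta>K: "\<delta> \<le> K" using \<delta>(2)[of 1] K[of 1 "a 1"] False by force
  then have \<kappa>1: "1 \<le> \<kappa>" using \<delta> by (simp add: \<kappa>_def)
  have t12: "\<tau> * (12 * N * \<kappa>\<^sup>2) \<le> 1" using t by (simp add: \<tau>_def \<kappa>_def N_def)
  have "\<tau> * (6 * \<kappa>\<^sup>2) \<le> \<tau> * (12 * N * \<kappa>\<^sup>2)"
    using N1 \<tau>0 by (intro mult_left_mono mult_right_mono) auto
  then have "\<tau> * (6 * \<kappa>\<^sup>2) \<le> 1" using t12 by (rule order_trans)
  then have t6: "norm t * (6 * (K / \<delta>)\<^sup>2) \<le> 1" by (simp only: \<tau>_def \<kappa>_def)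
  have "\<forall>j\<in>{1..m}. \<exists>\<mu>. poly g \<mu> = 0 \<and>
    norm (\<mu> - (a j - t * (poly q (a j) / poly (pderiv p) (a j)))) \<le> 6 * real m * (K / \<delta>) ^ 3 * (norm t)\<^sup>2"
    unfolding g_def
    by (intro ballI ex_root_of_perturbation)
       (use pa \<delta> K deg t6 in \<open>auto simp: g_def\<close>)
  then obtain \<mu> where \<mu>: "\<And>j. j \<in> {1..m} \<Longrightarrow> poly g (\<mu> j) = 0"
    "\<And>j. j \<in> {1..m} \<Longrightarrow> norm (\<mu> j - (a j - t * (poly q (a j) / poly (pderiv p) (a j))))
       \<le> 6 * N * \<kappa> ^ 3 * \<tau>\<^sup>2"
    unfolding N_def \<kappa>_def \<tau>_def by metis
  have near: "norm (\<mu> j - a j) \<le> 1 / (8 * \<kappa>)" if j: "j \<in> {1..m}" for j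
  proof -
    have "norm (poly q (a j) / poly (pderiv p) (a j)) \<le> \<kappa>"
      unfolding \<kappa>_def norm_divide using \<delta> \<delta>K K[OF j, of "a j"] j by (intro frac_le) auto
    then have tb: "norm (t * (poly q (a j) / poly (pderiv p) (a j))) \<le> \<tau> * \<kappa>"
      unfolding norm_mult \<tau>_def by (rule mult_left_mono) simp
    have "norm (\<mu> j - a j) \<le> 6 * N * \<kappa> ^ 3 * \<tau>\<^sup>2 + \<tau> * \<kappa>"
      using norm_triangle_le_diff[OF add_mono[OF \<mu>(2)[OF j] tb]] by (simp add: algebra_simps)
    \<comment> \<open>Both terms are expressed by the quantity \<open>12 N \<kappa>\<^sup>2 \<tau> \<le> 1\<close>.\<close>
    also have "\<dots> = ((\<tau> * (12 * N * \<kappa>\<^sup>2))\<^sup>2 / (24 * N) + \<tau> * (12 * N * \<kappa>\<^sup>2) / (12 * N)) / \<kappa>"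
      using N1 \<kappa>1 by (simp add: field_simps power2_eq_square power3_eq_cube)
    also have "\<dots> \<le> (1 / 24 + 1 / 12) / \<kappa>"
    proof (intro divide_right_mono add_mono)
      show "(\<tau> * (12 * N * \<kappa>\<^sup>2))\<^sup>2 / (24 * N) \<le> 1 / 24"
        using t12 N1 \<tau>0 by (intro frac_le power_le_one) auto
      show "\<tau> * (12 * N * \<kappa>\<^sup>2) / (12 * N) \<le> 1 / 12"
        using t12 N1 by (intro frac_le) auto
    qed (use \<kappa>1 in auto)
    finally show ?thesis by simp
  qed
  have "inj_on \<mu> {1..m}"
  proof (rule inj_onI, rule ccontr)
    fix j k assume jk: "j \<in> {1..m}" "k \<in> {1..m}" "\<mu> j = \<mu> k" "j \<noteq> k"
    then have "a j \<noteq> a k" using inj by (auto dest: inj_onD)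
    then have "\<delta> / K \<le> norm (a j - a k)"
      using jk pa \<delta> K by (intro simple_roots_separated) auto
    also have "norm (a j - a k) \<le> norm (\<mu> k - a k) + norm (\<mu> j - a j)"
      using norm_triangle_ineq4[of "\<mu> k - a k" "\<mu> j - a j"] jk by (simp add: algebra_simps)
    also have "\<dots> \<le> 1 / (8 * \<kappa>) + 1 / (8 * \<kappa>)" by (intro add_mono near jk)
    finally have "1 / \<kappa> \<le> 1 / (8 * \<kappa>) + 1 / (8 * \<kappa>)" by (simp add: \<kappa>_def)
    then show False using \<kappa>1 by (simp add: field_simps)
  qed
  then show ?thesis using \<mu> unfolding N_def \<kappa>_def \<tau>_def by blast
qed simp

section \<open>Symbols on the unit sphere\<close>

lemma poly_symb:
  "poly (symb c r \<zeta>) x = (\<Sum>(k, \<alpha>) \<in> {(k, \<alpha>). k + mi_order \<alpha> = r}. c k \<alpha> * (\<Prod>i\<in>UNIV. (\<zeta> $ i) ^ \<alpha> i) * x ^ k)"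
  unfolding symb_def poly_sum by (intro sum.cong refl) (auto simp: poly_monom)

text \<open>
  Differentiation in \<open>\<lambda>\<close> leaves the dependence on \<open>\<zeta>\<close> in scalar factors.  This form makes the joint
  continuity in \<open>\<zeta>\<close> and \<open>\<lambda>\<close>, for derivatives of any order, visible term by term.
\<close>

lemma higher_pderiv_symb:
  "(pderiv ^^ d) (symb c r \<zeta>) = (\<Sum>(k, \<alpha>) \<in> {(k, \<alpha>). k + mi_order \<alpha> = r}.
     smult (c k \<alpha> * (\<Prod>i\<in>UNIV. (\<zeta> $ i) ^ \<alpha> i)) ((pderiv ^^ d) (monom 1 k)))"
  unfolding symb_def higher_pderiv_sum
  by (intro sum.cong refl) (auto simp: smult_monom simp flip: higher_pderiv_smult)

lemma continuous_on_symb: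
  "continuous_on S (\<lambda>(\<omega>, x). poly ((pderiv ^^ d) (symb c r (cvec \<omega>))) x)"
  unfolding higher_pderiv_symb poly_sum case_prod_unfold cvec_def
  by (simp, intro continuous_intros)

lemma symb_bounded:
  fixes c :: "nat \<Rightarrow> ('n::finite \<Rightarrow> nat) \<Rightarrow> complex"
  shows "\<exists>K\<ge>0. \<forall>\<omega> x. norm \<omega> = 1 \<longrightarrow> norm x \<le> R \<longrightarrow>
    norm (poly ((pderiv ^^ d) (symb c r (cvec \<omega>))) x) \<le> K"
proof -
  have "compact ((\<lambda>(\<omega>, x). poly ((pderiv ^^ d) (symb c r (cvec \<omega>))) x) ` (sphere (0::real^'n) 1 \<times> cball 0 R))"
    by (intro compact_continuous_image continuous_on_symb compact_Times compact_sphere compact_cball)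
  then obtain K where "K > 0" "\<And>y. y \<in> (\<lambda>(\<omega>, x). poly ((pderiv ^^ d) (symb c r (cvec \<omega>))) x) ` (sphere (0::real^'n) 1 \<times> cball 0 R) \<Longrightarrow> norm y \<le> K"
    using compact_imp_bounded bounded_pos by metis
  then show ?thesis by (intro exI[of _ K]) force
qed

lemma coeff_symb_top:
  fixes c :: "nat \<Rightarrow> ('n::finite \<Rightarrow> nat) \<Rightarrow> complex"
  shows "coeff (symb c r \<zeta>) r = c r (\<lambda>_. 0)"
proof -
  have "coeff (symb c r \<zeta>) r = (\<Sum>x \<in> {(k, \<alpha> :: 'n \<Rightarrow> nat). k + mi_order \<alpha> = r}. if x = (r, \<lambda>_. 0) then c r (\<lambda>_. 0) else 0)"
    unfolding symb_def coeff_sum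
  proof (intro sum.cong refl, clarify)
    fix k and \<alpha> :: "'n \<Rightarrow> nat"
    have "mi_order \<alpha> = 0 \<longleftrightarrow> \<alpha> = (\<lambda>_. 0)" by (auto simp: mi_order_def)
    then show "coeff (monom (c k \<alpha> * (\<Prod>i\<in>UNIV. \<zeta> $ i ^ \<alpha> i)) k) (k + mi_order \<alpha>) =
        (if (k, \<alpha>) = (k + mi_order \<alpha>, \<lambda>_. 0) then c (k + mi_order \<alpha>) (\<lambda>_. 0) else 0)"
      by (auto simp: coeff_monom)
  qed
  also have "\<dots> = c r (\<lambda>_. 0)"
    by (subst sum.delta[OF finite_symb_index]) (auto simp: mi_order_def)
  finally show ?thesis .
qed

lemma degree_symb_le: "degree (symb c r \<zeta>) \<le> r"
  unfolding symb_def by (rule degree_sum_le[OF finite_symb_index]) (auto intro: order_trans[OF degree_monom_le])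

lemma degree_symb_monic:
  assumes "c m (\<lambda>_. 0) = 1"
  shows "degree (symb c m \<zeta>) = m"
  using assms by (intro antisym degree_symb_le le_degree) (simp add: coeff_symb_top)

text \<open>
  On the unit sphere all monomials in \<open>\<omega>\<close> have modulus at most \<open>1\<close>, so the coefficients of the monic
  polynomial are bounded independently of \<open>\<omega>\<close>.
\<close>

lemma symb_roots_bounded:
  fixes c :: "nat \<Rightarrow> ('n::finite \<Rightarrow> nat) \<Rightarrow> complex"
  assumes "c m (\<lambda>_. 0) = 1"
  shows "\<exists>R. \<forall>(\<omega> :: real^'n) x. norm \<omega> = 1 \<longrightarrow> poly (symb c m (cvec \<omega>)) x = 0 \<longrightarrow> norm x \<le> R"
proof -
  define B where "B = (\<Sum>(k, \<alpha>) \<in> {(k, \<alpha> :: 'n \<Rightarrow> nat). k + mi_order \<alpha> = m}. norm (c k \<alpha>))"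
  have "norm x \<le> max 1 (real m * B)"
    if \<omega>: "norm \<omega> = 1" and root: "poly (symb c m (cvec \<omega>)) x = 0" for \<omega> :: "real^'n" and x
  proof (rule norm_root_le_of_monic[OF degree_symb_monic _ root])
    fix k
    show "norm (coeff (symb c m (cvec \<omega>)) k) \<le> B"
      unfolding symb_def coeff_sum B_def
    proof (rule sum_norm_le, clarify)
      fix k' and \<alpha> :: "'n \<Rightarrow> nat"
      have "norm (cvec \<omega> $ i) \<le> 1" for i
        using component_le_norm_cart[of \<omega> i] \<omega> by (simp add: cvec_def)
      then have "(\<Prod>i\<in>UNIV. norm (cvec \<omega> $ i) ^ \<alpha> i) \<le> 1"
        by (intro prod_le_1) (auto intro: power_le_one)
      then have "norm (c k' \<alpha>) * (\<Prod>i\<in>UNIV. norm (cvec \<omega> $ i) ^ \<alpha> i) \<le> norm (c k' \<alpha>)"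
        by (rule mult_left_le) simp
      then show "norm (coeff (monom (c k' \<alpha> * (\<Prod>i\<in>UNIV. cvec \<omega> $ i ^ \<alpha> i)) k') k) \<le> norm (c k' \<alpha>)"
        by (auto simp: coeff_monom norm_mult prod_norm[symmetric] norm_power)
    qed
  qed (use assms in \<open>simp_all add: coeff_symb_top\<close>)
  then show ?thesis by blast
qed

text \<open>
  The roots over the unit sphere form a compact set of pairs \<open>(\<omega>, x)\<close>: they are bounded by the previous
  lemma and closed by continuity.  Simplicity of the roots says that the derivative has no zero there,
  so its modulus has a positive minimum.
\<close>

lemma pderiv_symb_bounded_below:
  fixes c :: "nat \<Rightarrow> ('n::finite \<Rightarrow> nat) \<Rightarrow> complex"
  assumes "c m (\<lambda>_. 0) = 1" and sf: "\<And>\<omega> :: real^'n. norm \<omega> = 1 \<Longrightarrow> rsquarefree (symb c m (cvec \<omega>))"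
  shows "\<exists>\<delta>>0. \<forall>(\<omega> :: real^'n) x. norm \<omega> = 1 \<longrightarrow> poly (symb c m (cvec \<omega>)) x = 0 \<longrightarrow>
    \<delta> \<le> norm (poly (pderiv (symb c m (cvec \<omega>))) x)"
proof -
  obtain R where R: "\<And>(\<omega> :: real^'n) x. norm \<omega> = 1 \<Longrightarrow> poly (symb c m (cvec \<omega>)) x = 0 \<Longrightarrow> norm x \<le> R"
    using symb_roots_bounded[of c m, OF assms(1)] by blast
  define T where "T = {y \<in> sphere (0::real^'n) 1 \<times> cball 0 R. (\<lambda>(\<omega>, x). poly (symb c m (cvec \<omega>)) x) y = 0}"
  have "closed T"
    unfolding T_def
    using continuous_closed_preimage_constant[OF continuous_on_symb[of _ 0 c m, simplified]
        closed_Times[OF closed_sphere closed_cball], of 0] by simp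
  moreover have "T \<subseteq> sphere 0 1 \<times> cball 0 R" by (auto simp: T_def)
  ultimately have "compact T"
    by (metis compact_Int_closed compact_Times compact_cball compact_sphere inf.absorb2)
  moreover have cont: "continuous_on T (\<lambda>y. norm ((\<lambda>(\<omega>, x). poly (pderiv (symb c m (cvec \<omega>))) x) y))"
    using continuous_on_norm[OF continuous_on_symb[of T 1 c m]] by simp
  show ?thesis
  proof (cases "T = {}")
    case True
    then have "\<And>(\<omega> :: real^'n) x. norm \<omega> = 1 \<Longrightarrow> poly (symb c m (cvec \<omega>)) x \<noteq> 0"
      using R by (fastforce simp: T_def)
    then show ?thesis by (intro exI[of _ 1]) auto
  next
    case False
    obtain y where y: "y \<in> T" and min: "\<And>z. z \<in> T \<Longrightarrow>
        norm ((\<lambda>(\<omega>, x). poly (pderiv (symb c m (cvec \<omega>))) x) y)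
        \<le> norm ((\<lambda>(\<omega>, x). poly (pderiv (symb c m (cvec \<omega>))) x) z)"
      using continuous_attains_inf[OF \<open>compact T\<close> False cont] by blast
    have "norm ((\<lambda>(\<omega>, x). poly (pderiv (symb c m (cvec \<omega>))) x) y) > 0"
      using y sf unfolding T_def rsquarefree_roots by auto
    then show ?thesis
      using min R unfolding T_def by (intro exI conjI) (assumption, fastforce)
  qed
qed

lemma poly_symb_ivec_scale:
  fixes c :: "nat \<Rightarrow> ('n::finite \<Rightarrow> nat) \<Rightarrow> complex"
  assumes "\<xi> = \<rho> *\<^sub>R \<omega>"
  shows "poly (symb c r (ivec \<xi>)) (\<i> * of_real \<rho> * x) = (\<i> * of_real \<rho>) ^ r * poly (symb c r (cvec \<omega>)) x"
  unfolding poly_symb sum_distrib_left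
proof (intro sum.cong refl, clarify)
  fix k and \<alpha> :: "'n \<Rightarrow> nat"
  define s :: complex where "s = \<i> * of_real \<rho>"
  have "(\<Prod>i\<in>UNIV. ivec \<xi> $ i ^ \<alpha> i) = (\<Prod>i\<in>UNIV. s ^ \<alpha> i * cvec \<omega> $ i ^ \<alpha> i)"
    by (intro prod.cong refl) (simp add: ivec_def cvec_def assms s_def power_mult_distrib)
  also have "\<dots> = s ^ mi_order \<alpha> * (\<Prod>i\<in>UNIV. cvec \<omega> $ i ^ \<alpha> i)"
    by (simp add: prod.distrib mi_order_def power_sum)
  finally have "c k \<alpha> * (\<Prod>i\<in>UNIV. ivec \<xi> $ i ^ \<alpha> i) * (s * x) ^ k
      = s ^ (k + mi_order \<alpha>) * (c k \<alpha> * (\<Prod>i\<in>UNIV. cvec \<omega> $ i ^ \<alpha> i) * x ^ k)"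
    by (simp add: power_mult_distrib power_add)
  then show "c k \<alpha> * (\<Prod>i\<in>UNIV. ivec \<xi> $ i ^ \<alpha> i) * (\<i> * of_real \<rho> * x) ^ k =
      (\<i> * of_real \<rho>) ^ (k + mi_order \<alpha>) * (c k \<alpha> * (\<Prod>i\<in>UNIV. cvec \<omega> $ i ^ \<alpha> i) * x ^ k)"
    by (simp add: s_def)
qed

lemma poly_symb_check_root:
  assumes "poly (symb c m \<zeta>) a = 0"
  shows "poly (symb_check c m a \<zeta>) a = poly (pderiv (symb c m \<zeta>)) a"
proof -
  define q where "q = symb_check c m a \<zeta>"
  have "symb c m \<zeta> = [:- a, 1:] * q"
    using assms unfolding q_def symb_check_def by (metis dvd_mult_div_cancel poly_eq_0_iff_dvd)
  then have "pderiv (symb c m \<zeta>) = q + [:- a, 1:] * pderiv q"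
    by (simp only: pderiv_mult) (simp add: pderiv_pCons)
  then show ?thesis by (simp add: q_def)
qed

lemma Qpoly_monic:
  assumes "c m (\<lambda>_. 0) = 1" and "l \<le> m"
  shows "degree (Qpoly c m l \<zeta>) = m" and "Qpoly c m l \<zeta> \<noteq> 0"
proof -
  have le: "degree (Qpoly c m l \<zeta>) \<le> m"
    unfolding Qpoly_def by (rule degree_sum_le) (auto intro: order_trans[OF degree_symb_le])
  have "coeff (symb c (m - j) \<zeta>) m = 0" if "j \<in> {0..l} - {0}" for j
    using that assms(2) by (intro coeff_eq_0 le_less_trans[OF degree_symb_le]) auto
  then have "coeff (Qpoly c m l \<zeta>) m = 1"
    unfolding Qpoly_def coeff_sum
    by (subst sum.remove[of _ 0]) (auto simp: coeff_symb_top assms(1))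
  then show "degree (Qpoly c m l \<zeta>) = m" "Qpoly c m l \<zeta> \<noteq> 0"
    using le le_degree[of "Qpoly c m l \<zeta>" m] by auto
qed

text \<open>
  Homogeneity turns \<open>Q\<close>, read in the variable \<open>\<lambda> = s x\<close>, into a perturbation of \<open>P\<^sub>m\<close> in the small
  parameter \<open>1 / s\<close>.  The terms of order at least two are collected with the factor \<open>(1 / s)\<^sup>2\<close> in
  front, so that what remains of them stays bounded.
\<close>

lemma poly_Qpoly_ivec_scale:
  fixes c :: "nat \<Rightarrow> ('n::finite \<Rightarrow> nat) \<Rightarrow> complex"
  assumes \<xi>: "\<xi> = \<rho> *\<^sub>R \<omega>" and s: "s = \<i> * of_real \<rho>" "s \<noteq> 0" and l: "1 \<le> l" "l \<le> m"
  shows "poly (Qpoly c m l (ivec \<xi>)) (s * x) = s ^ m *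
    poly (symb c m (cvec \<omega>) + smult (1 / s) (symb c (m - 1) (cvec \<omega>)) +
      smult ((1 / s)\<^sup>2) (\<Sum>j=2..l. smult ((1 / s) ^ (j - 2)) (symb c (m - j) (cvec \<omega>)))) x"
proof -
  define t where "t = 1 / s"
  define P where "P j = poly (symb c (m - j) (cvec \<omega>)) x" for j
  have "poly (Qpoly c m l (ivec \<xi>)) (s * x) = (\<Sum>j=0..l. s ^ (m - j) * P j)"
    unfolding Qpoly_def poly_sum P_def s(1) by (simp only: poly_symb_ivec_scale[OF \<xi>])
  also have "\<dots> = s ^ m * (\<Sum>j=0..l. t ^ j * P j)"
    unfolding sum_distrib_left t_def using l s(2)
    by (intro sum.cong) (auto simp: power_diff power_divide)
  also have "(\<Sum>j=0..l. t ^ j * P j) = P 0 + t * P 1 + (\<Sum>j=2..l. t ^ j * P j)"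
    using l by (simp add: sum.atLeast_Suc_atMost numeral_2_eq_2)
  also have "(\<Sum>j=2..l. t ^ j * P j) = t\<^sup>2 * (\<Sum>j=2..l. t ^ (j - 2) * P j)"
    unfolding sum_distrib_left
  proof (intro sum.cong refl)
    fix j assume "j \<in> {2..l}"
    then have "t ^ j = t\<^sup>2 * t ^ (j - 2)" by (metis atLeastAtMost_iff le_add_diff_inverse power_add)
    then show "t ^ j * P j = t\<^sup>2 * (t ^ (j - 2) * P j)" by simp
  qed
  finally show ?thesis by (simp add: poly_sum P_def t_def)
qed

section \<open>Asymptotics of the roots\<close>

theorem lemma2p2:
  fixes c :: "nat \<Rightarrow> ('n::finite \<Rightarrow> nat) \<Rightarrow> complex"
    and m l :: nat
    and a :: "nat \<Rightarrow> real ^ 'n \<Rightarrow> real"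
  assumes "1 \<le> l" and "l \<le> m"
    and "c m (\<lambda>_. 0) = 1"
    and "c (m - l) (\<lambda>_. 0) > 0"
    and "strictly_hyperbolic c (m - 1)"
    and "strictly_hyperbolic c m"
    and "\<And>\<omega> :: real ^ 'n. norm \<omega> = 1 \<Longrightarrow>
           strictly_interlace m (symb c (m - 1) (cvec \<omega>)) (symb c m (cvec \<omega>))"
    and "\<And>\<omega> :: real ^ 'n. norm \<omega> = 1 \<Longrightarrow>
           bij_betw (\<lambda>j. a j \<omega>) {1..m} {x. poly (symb c m (cvec \<omega>)) (complex_of_real x) = 0}"
  shows "\<exists>lam :: nat \<Rightarrow> real ^ 'n \<Rightarrow> complex.
           (\<forall>\<xi>. proots (Qpoly c m l (ivec \<xi>)) = image_mset (\<lambda>j. lam j \<xi>) (mset_set {1..m})) \<and>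
           (\<forall>j\<in>{1..m}.
              (\<lambda>\<xi>. let \<omega> = \<xi> /\<^sub>R norm \<xi>; aj = complex_of_real (a j \<omega>) in
                 lam j \<xi> - (\<i> * complex_of_real (norm \<xi>) * aj
                   - poly (symb c (m - 1) (cvec \<omega>)) aj / poly (symb_check c m aj (cvec \<omega>)) aj))
              \<in> o[at_infinity](\<lambda>_. 1))"
proof -
  have m: "m \<ge> 1" using assms(1,2) by simp
  obtain R where R: "\<And>(\<omega> :: real^'n) x. norm \<omega> = 1 \<Longrightarrow> poly (symb c m (cvec \<omega>)) x = 0 \<Longrightarrow> norm x \<le> R"
    using symb_roots_bounded[of c m, OF assms(3)] by blast
  obtain \<delta> where \<delta>: "0 < \<delta>"
    and \<delta>_le: "\<And>(\<omega> :: real^'n) x. norm \<omega> = 1 \<Longrightarrow> poly (symb c m (cvec \<omega>)) x = 0 \<Longrightarrow>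
      \<delta> \<le> norm (poly (pderiv (symb c m (cvec \<omega>))) x)"
    using pderiv_symb_bounded_below[of c m, OF assms(3)] assms(6)
    unfolding strictly_hyperbolic_def by blast
  have "\<forall>d r. \<exists>K\<ge>0. \<forall>(\<omega> :: real^'n) x. norm \<omega> = 1 \<longrightarrow> norm x \<le> R + 1 \<longrightarrow>
      norm (poly ((pderiv ^^ d) (symb c r (cvec \<omega>))) x) \<le> K"
    using symb_bounded by blast
  then obtain L where L0: "\<And>d r. 0 \<le> L d r" and L: "\<And>d r (\<omega> :: real^'n) x. norm \<omega> = 1 \<Longrightarrow> norm x \<le> R + 1 \<Longrightarrow>
      norm (poly ((pderiv ^^ d) (symb c r (cvec \<omega>))) x) \<le> L d r"
    by metis
  \<comment> \<open>One bound for all derivatives up to order two of all symbols of order at most \<open>m\<close>, on a ball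
    that contains the discs of radius \<open>1\<close> around the roots.\<close>
  define K where "K = (\<Sum>d\<le>2. \<Sum>r\<le>m. L d r)"
  have LK: "L d r \<le> K" if "d \<le> 2" "r \<le> m" for d r
  proof -
    have "L d r \<le> (\<Sum>r\<le>m. L d r)" using that L0 by (intro member_le_sum) auto
    also have "\<dots> \<le> K" unfolding K_def
      using that L0 by (intro member_le_sum[of d "{..2}" "\<lambda>d. \<Sum>r\<le>m. L d r"] sum_nonneg) auto
    finally show ?thesis .
  qed
  have K0: "0 \<le> K" unfolding K_def by (intro sum_nonneg L0)
  \<comment> \<open>The remainder \<open>r\<close> is a sum of fewer than \<open>m\<close> symbols with factors of modulus at most \<open>1\<close>.\<close>
  define M where "M = real m * K"
  have KM: "K \<le> M" using m K0 mult_right_mono[of 1 "real m" K] by (simp add: M_def)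
  define C where "C = 6 * real m * (M / \<delta>) ^ 3"
  \<comment> \<open>From this radius on \<open>1 / \<rho>\<close> is small enough for the perturbation argument.\<close>
  define \<rho>0 where "\<rho>0 = max 1 (12 * real m * (M / \<delta>)\<^sup>2)"
  define approx where "approx j \<xi> = (let \<omega> = \<xi> /\<^sub>R norm \<xi>; aj = complex_of_real (a j \<omega>) in
      \<i> * complex_of_real (norm \<xi>) * aj
        - poly (symb c (m - 1) (cvec \<omega>)) aj / poly (symb_check c m aj (cvec \<omega>)) aj)" for j \<xi>

  have large: "\<exists>f. proots (Qpoly c m l (ivec \<xi>)) = image_mset f (mset_set {1..m}) \<and>
      (\<forall>j\<in>{1..m}. norm (f j - approx j \<xi>) \<le> C / norm \<xi>)" if \<xi>: "\<rho>0 \<le> norm \<xi>" for \<xi>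
  proof -
    define \<rho> where "\<rho> = norm \<xi>"
    define \<omega> where "\<omega> = \<xi> /\<^sub>R norm \<xi>"
    define s where "s = \<i> * complex_of_real \<rho>"
    define t where "t = 1 / s"
    define A where "A j = complex_of_real (a j \<omega>)" for j
    define r where "r = (\<Sum>j=2..l. smult (t ^ (j - 2)) (symb c (m - j) (cvec \<omega>)))"
    define g where "g = symb c m (cvec \<omega>) + smult t (symb c (m - 1) (cvec \<omega>)) + smult (t\<^sup>2) r"
    have \<rho>: "1 \<le> \<rho>" "12 * real m * (M / \<delta>)\<^sup>2 \<le> \<rho>" using \<xi> by (auto simp: \<rho>_def \<rho>0_def)
    have "norm \<xi> \<noteq> 0" using \<rho> by (auto simp: \<rho>_def)
    then have \<omega>: "norm \<omega> = 1" and \<xi>\<omega>: "\<xi> = \<rho> *\<^sub>R \<omega>"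
      by (auto simp: \<omega>_def \<rho>_def)
    have s0: "s \<noteq> 0" and nt: "norm t = 1 / \<rho>" and ns: "norm s = \<rho>"
      using \<rho> by (auto simp: s_def t_def norm_mult norm_divide)
    have bij: "bij_betw (\<lambda>j. a j \<omega>) {1..m} {x. poly (symb c m (cvec \<omega>)) (complex_of_real x) = 0}"
      by (rule assms(8)[OF \<omega>])
    have injA: "inj_on A {1..m}"
      using bij_betw_imp_inj_on[OF bij] unfolding A_def inj_on_def of_real_eq_iff .
    have rootA: "poly (symb c m (cvec \<omega>)) (A j) = 0" if "j \<in> {1..m}" for j
      using bij_betw_apply[OF bij that] unfolding A_def by (simp only: mem_Collect_eq)
    have P: "norm (poly ((pderiv ^^ d) (symb c k (cvec \<omega>))) x) \<le> K"
      if "d \<le> 2" "k \<le> m" "norm x \<le> R + 1" for d k x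
      using L[OF \<omega> that(3)] LK[OF that(1,2)] by (rule order_trans)
    have r: "norm (poly ((pderiv ^^ d) r) x) \<le> M" if "d \<le> 2" "norm x \<le> R + 1" for d x
    proof -
      have "norm (poly ((pderiv ^^ d) r) x) \<le> (\<Sum>j=2..l. K)"
        unfolding r_def higher_pderiv_sum higher_pderiv_smult poly_sum poly_smult
      proof (rule sum_norm_le)
        fix j
        have "norm (t ^ (j - 2)) \<le> 1"
          unfolding norm_power nt using \<rho> by (intro power_le_one) auto
        then have "norm (t ^ (j - 2)) * norm (poly ((pderiv ^^ d) (symb c (m - j) (cvec \<omega>))) x) \<le> 1 * K"
          using that by (intro mult_mono P) auto
        then show "norm (t ^ (j - 2) * poly ((pderiv ^^ d) (symb c (m - j) (cvec \<omega>))) x) \<le> K"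
          by (simp add: norm_mult)
      qed
      also have "\<dots> \<le> M" unfolding M_def using assms(1,2) K0 by (auto intro!: mult_right_mono)
      finally show ?thesis .
    qed
    have ball: "norm x \<le> R + 1" if "j \<in> {1..m}" "x \<in> cball (A j) 1" for j x
      using R[OF \<omega> rootA[OF that(1)]] that(2) norm_triangle_sub[of x "A j"]
      by (simp add: dist_norm norm_minus_commute)
    have error: "6 * real m * (M / \<delta>) ^ 3 * (norm t)\<^sup>2 = C / \<rho>\<^sup>2"
      by (simp add: C_def nt power_divide)
    have "\<exists>\<mu>. inj_on \<mu> {1..m} \<and> (\<forall>j\<in>{1..m}. poly g (\<mu> j) = 0 \<and>
      norm (\<mu> j - (A j - t * (poly (symb c (m - 1) (cvec \<omega>)) (A j) / poly (pderiv (symb c m (cvec \<omega>))) (A j))))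
        \<le> C / \<rho>\<^sup>2)"
      unfolding g_def error[symmetric]
    proof (rule perturbed_roots)
      fix j x assume "j \<in> {1..m}" "x \<in> cball (A j) 1"
      then have x: "norm x \<le> R + 1" by (rule ball)
      show "norm (poly (pderiv (symb c m (cvec \<omega>))) x) \<le> M \<and>
        norm (poly (pderiv (pderiv (symb c m (cvec \<omega>)))) x) \<le> M \<and>
        norm (poly (symb c (m - 1) (cvec \<omega>)) x) \<le> M \<and>
        norm (poly (pderiv (symb c (m - 1) (cvec \<omega>))) x) \<le> M \<and>
        norm (poly r x) \<le> M \<and> norm (poly (pderiv r) x) \<le> M"
        using P[of 1 m x] P[of 2 m x] P[of 0 "m - 1" x] P[of 1 "m - 1" x] r[of 0 x] r[of 1 x] x KM
        by (auto simp: numeral_2_eq_2)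
    next
      show "degree (symb c m (cvec \<omega>) + smult t (symb c (m - 1) (cvec \<omega>)) + smult (t\<^sup>2) r) \<le> m"
        unfolding r_def
        by (intro degree_add_le order_trans[OF degree_smult_le] degree_sum_le
            order_trans[OF degree_symb_le]) auto
      show "norm t * (12 * real m * (M / \<delta>)\<^sup>2) \<le> 1"
        unfolding nt times_divide_eq_left mult_1 using \<rho> by (intro divide_le_eq_1_pos[THEN iffD2]) auto
    qed (use injA rootA \<delta> \<delta>_le[OF \<omega>] in auto)
    then obtain \<mu> where inj: "inj_on \<mu> {1..m}" and root: "\<And>j. j \<in> {1..m} \<Longrightarrow> poly g (\<mu> j) = 0"
      and close: "\<And>j. j \<in> {1..m} \<Longrightarrow> norm (\<mu> j - (A j - t * (poly (symb c (m - 1) (cvec \<omega>)) (A j)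
        / poly (pderiv (symb c m (cvec \<omega>))) (A j)))) \<le> C / \<rho>\<^sup>2"
      by blast
    have "proots (Qpoly c m l (ivec \<xi>)) = image_mset (\<lambda>j. s * \<mu> j) (mset_set {1..m})"
    proof (rule proots_eq_if_distinct_roots)
      show "inj_on (\<lambda>j. s * \<mu> j) {1..m}" using inj s0 unfolding inj_on_def mult_cancel_left by blast
      show "poly (Qpoly c m l (ivec \<xi>)) (s * \<mu> j) = 0" if "j \<in> {1..m}" for j
        using poly_Qpoly_ivec_scale[OF \<xi>\<omega> s_def s0 assms(1,2), of c "\<mu> j"] root[OF that]
        unfolding g_def r_def t_def by (simp only: mult_zero_right)
    qed (use Qpoly_monic[of c m l, OF assms(3,2)] in auto)
    moreover have "norm (s * \<mu> j - approx j \<xi>) \<le> C / norm \<xi>" if j: "j \<in> {1..m}" for j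
    proof -
      define b where "b = poly (symb c (m - 1) (cvec \<omega>)) (A j) / poly (pderiv (symb c m (cvec \<omega>))) (A j)"
      have "approx j \<xi> = s * A j - b"
        unfolding approx_def Let_def b_def
        using poly_symb_check_root[OF rootA[OF j]] by (simp add: s_def \<rho>_def A_def \<omega>_def)
      then have "s * \<mu> j - approx j \<xi> = s * (\<mu> j - (A j - t * b))"
        using s0 by (simp add: t_def algebra_simps)
      then have "norm (s * \<mu> j - approx j \<xi>) = \<rho> * norm (\<mu> j - (A j - t * b))"
        by (simp only: norm_mult ns)
      also have "\<dots> \<le> \<rho> * (C / \<rho>\<^sup>2)"
        unfolding b_def using close[OF j] \<rho> by (intro mult_left_mono) auto
      also have "\<dots> = C / norm \<xi>" using \<rho> by (simp add: power2_eq_square flip: \<rho>_def)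
      finally show ?thesis .
    qed
    ultimately show ?thesis by blast
  qed
  \<comment> \<open>For the remaining \<open>\<xi>\<close>, \<open>\<xi> = 0\<close> included, any enumeration of the roots will do.\<close>
  have "\<forall>\<xi>. \<exists>f. proots (Qpoly c m l (ivec \<xi>)) = image_mset f (mset_set {1..m}) \<and>
      (\<rho>0 \<le> norm \<xi> \<longrightarrow> (\<forall>j\<in>{1..m}. norm (f j - approx j \<xi>) \<le> C / norm \<xi>))"
    using large ex_image_mset_of_size[OF size_proots_complex]
      Qpoly_monic(1)[of c m l, OF assms(3,2)] by metis
  then obtain f where proots: "\<And>\<xi>. proots (Qpoly c m l (ivec \<xi>)) = image_mset (f \<xi>) (mset_set {1..m})"
    and close: "\<And>\<xi> j. \<rho>0 \<le> norm \<xi> \<Longrightarrow> j \<in> {1..m} \<Longrightarrow> norm (f \<xi> j - approx j \<xi>) \<le> C / norm \<xi>"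
    by metis
  have small: "(\<lambda>\<xi>. f \<xi> j - approx j \<xi>) \<in> o[at_infinity](\<lambda>_. 1)" if j: "j \<in> {1..m}" for j
  proof (rule smalloI_tendsto)
    have "((\<lambda>\<xi>::real^'n. C / norm \<xi>) \<longlongrightarrow> 0) at_infinity"
      by (rule tendsto_divide_0[OF tendsto_const filterlim_at_top_imp_at_infinity[OF filterlim_norm_at_top]])
    moreover have "eventually (\<lambda>\<xi>. norm (f \<xi> j - approx j \<xi>) \<le> C / norm \<xi>) at_infinity"
      unfolding eventually_at_infinity using close j by blast
    ultimately have "((\<lambda>\<xi>. f \<xi> j - approx j \<xi>) \<longlongrightarrow> 0) at_infinity"
      by (rule Lim_null_comparison[rotated])
    then show "((\<lambda>\<xi>. (f \<xi> j - approx j \<xi>) / 1) \<longlongrightarrow> 0) at_infinity" by simp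
  qed simp
  show ?thesis
    by (rule exI[of _ "\<lambda>j \<xi>. f \<xi> j"])
       (use proots small in \<open>simp add: approx_def Let_def\<close>)
qed

end
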